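(* Let $\mathfrak{O}$ be the valuation ring of a non-Archimedean local field of arbitrary characteristic, with residue field size $q$, and let $\mathfrak{d}_d(\mathfrak{O})\subset\mathrm{M}_d(\mathfrak{O})$ be the module of diagonal $d\times d$ matrices ($d\ge1$). Then $$\mathsf{Z}_{\mathfrak{d}_d(\mathfrak{O})}(T) = \frac{h_d(-q^{-1},T)}{(1-T)^{d+1}}.$$
   Context: Let $\mathrm{B}_n=\{\pm1\}\wr \mathrm{S}_n$ be the hyperoctahedral group of signed permutations on $n$ letters, i.e. permutations $\sigma$ of $\{\pm1,\dots,\pm n\}$ with $(-i)^\sigma=-(i^\sigma)$. For $\sigma\in \mathrm{B}_n$, let $\mathrm{N}(\sigma)=\#\{i\in\{1,\dots,n\}: i^\sigma<0\}$ and $\mathrm{d_B}(\sigma)=\#\{i\in\{0,\dots,n-1\}: i^\sigma>(i+1)^\sigma\}$, where $0^\sigma=0$. Define $h_n(X,Y)=\sum_{\sigma\in \mathrm{B}_n}X^{\mathrm{N}(\sigma)}Y^{\mathrm{d_B}(\sigma)}$. Let $\mathfrak{P}$ be the maximal ideal of $\mathfrak{O}$ and $\mathfrak{O}_n=\mathfrak{O}/\mathfrak{P}^n$. For an $\mathfrak{O}$-submodule $M\subset\mathrm{M}_{d}(\mathfrak{O})$, let $M_n$ be its image in $\mathrm{M}_{d}(\mathfrak{O}_n)$ under entrywise reduction. The ask zeta function of $M$ is $\mathsf{Z}_M(T)=\sum_{n=0}^\infty \bigl(|M_n|^{-1}\sum_{a\in M_n}|\mathrm{Ker}(a)|\bigr)T^n$,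 where $\mathrm{Ker}(a)=\{x\in\mathfrak{O}_n^d: xa=0\}$ (row vectors). *)

theory Defs
  imports
    Complex_Main
    "HOL-Algebra.QuotRing"
    "HOL-Algebra.Ideal_Product"
    "HOL-Algebra.Subrings"
    "HOL-Combinatorics.Permutations"
    "HOL-Computational_Algebra.Formal_Power_Series"
    "Jordan_Normal_Form.Matrix"
begin

section \<open>Non-Archimedean local fields\<close>

definition val_ring :: "('a, 'b) ring_scheme \<Rightarrow> ('a \<Rightarrow> real) \<Rightarrow> ('a, 'b) ring_scheme" where
  "val_ring K \<nu> = K\<lparr>carrier := {x \<in> carrier K. \<nu> x \<le> 1}\<rparr>"

definition val_ideal :: "('a, 'b) ring_scheme \<Rightarrow> ('a \<Rightarrow> real) \<Rightarrow> 'a set" where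
  "val_ideal K \<nu> = {x \<in> carrier K. \<nu> x < 1}"

locale nonarch_valued_field = field K for K (structure) +
  fixes \<nu> :: "'a \<Rightarrow> real"
  assumes abs_zero: "\<nu> \<zero> = 0"
    and abs_pos: "\<lbrakk>x \<in> carrier K; x \<noteq> \<zero>\<rbrakk> \<Longrightarrow> 0 < \<nu> x"
    and abs_mult: "\<lbrakk>x \<in> carrier K; y \<in> carrier K\<rbrakk> \<Longrightarrow> \<nu> (x \<otimes> y) = \<nu> x * \<nu> y"
    and abs_ultrametric:
      "\<lbrakk>x \<in> carrier K; y \<in> carrier K\<rbrakk> \<Longrightarrow> \<nu> (x \<oplus> y) \<le> max (\<nu> x) (\<nu> y)"

text \<open>
  A non-Archimedean local field is a field, of any characteristic, that is complete with
  respect to a nontrivial discrete absolute value and has finite residue field. The absolute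
  value is not required to be normalised: any generator \<open>c\<close> of the value group is allowed.
\<close>

locale nonarch_local_field = nonarch_valued_field +
  assumes discrete:
      "\<exists>c. 0 < c \<and> c < 1 \<and> \<nu> ` (carrier K - {\<zero>}) = range (\<lambda>k::int. c powi k)"
    and complete:
      "\<lbrakk>\<And>n. X n \<in> carrier K;
        \<And>e. 0 < e \<Longrightarrow> \<exists>N. \<forall>m\<ge>N. \<forall>n\<ge>N. \<nu> (X m \<ominus> X n) < e\<rbrakk>
       \<Longrightarrow> \<exists>L\<in>carrier K. (\<lambda>n::nat. \<nu> (X n \<ominus> L)) \<longlonglongrightarrow> 0"
    and finite_residue_field: "finite (carrier (val_ring K \<nu> Quot val_ideal K \<nu>))"

definition residue_card :: "('a, 'b) ring_scheme \<Rightarrow> ('a \<Rightarrow> real) \<Rightarrow> nat" where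
  "residue_card K \<nu> = card (carrier (val_ring K \<nu> Quot val_ideal K \<nu>))"

text \<open>
  The last lemma of this context, \<open>maximalideal_val_ring_iff\<close>, shows that
  \<^const>\<open>val_ideal\<close> is the unique maximal ideal of the valuation ring.
\<close>

context nonarch_valued_field
begin

lemma abs_nonneg: "x \<in> carrier K \<Longrightarrow> 0 \<le> \<nu> x"
  using abs_zero abs_pos by (cases "x = \<zero>") (auto intro: less_imp_le)

lemma abs_one: "\<nu> \<one> = 1"
  using abs_mult[of \<one> \<one>] abs_pos[of \<one>] by simp

lemma abs_minus: assumes "x \<in> carrier K" shows "\<nu> (\<ominus> x) = \<nu> x"
proof -
  have "\<nu> (\<ominus> \<one>) * \<nu> (\<ominus> \<one>) = 1"
    using abs_mult[of "\<ominus> \<one>" "\<ominus> \<one>"] abs_one by (simp add: l_minus r_minus)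
  then have "\<nu> (\<ominus> \<one>) = 1"
    using abs_nonneg[of "\<ominus> \<one>"] by (simp add: square_eq_1_iff)
  then show ?thesis
    using abs_mult[of "\<ominus> \<one>" x] assms by (simp add: l_minus)
qed

lemma abs_inv:
  assumes "x \<in> carrier K" "x \<noteq> \<zero>"
  shows "inv x \<in> carrier K" "x \<otimes> inv x = \<one>" "\<nu> (inv x) = inverse (\<nu> x)"
proof -
  have u: "x \<in> Units K" using assms by (simp add: field_Units)
  show "inv x \<in> carrier K" "x \<otimes> inv x = \<one>" using u by auto
  then show "\<nu> (inv x) = inverse (\<nu> x)"
    using abs_mult[of x "inv x"] abs_one assms(1)
    by (metis inverse_unique)
qed

lemma val_ring_subcring: "subcring {x \<in> carrier K. \<nu> x \<le> 1} K"
proof (rule subcringI')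
  show "subring {x \<in> carrier K. \<nu> x \<le> 1} K"
  proof (rule ring.subringI)
    show "ring K" by (rule ring_axioms)
  next
    fix x y assume xy: "x \<in> {x \<in> carrier K. \<nu> x \<le> 1}" "y \<in> {x \<in> carrier K. \<nu> x \<le> 1}"
    show "x \<otimes> y \<in> {x \<in> carrier K. \<nu> x \<le> 1}"
      using xy abs_mult[of x y] abs_nonneg by (auto intro: mult_le_one)
    show "x \<oplus> y \<in> {x \<in> carrier K. \<nu> x \<le> 1}"
      using xy abs_ultrametric[of x y] by auto
  qed (auto simp: abs_one abs_minus)
qed

lemma val_ring_cring: "cring (val_ring K \<nu>)"
  using subcring_iff[of "{x \<in> carrier K. \<nu> x \<le> 1}"] val_ring_subcring
  by (auto simp: val_ring_def)

lemma val_ideal_ideal: "ideal (val_ideal K \<nu>) (val_ring K \<nu>)"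
proof (rule idealI)
  interpret R: cring "val_ring K \<nu>" by (rule val_ring_cring)
  show "ring (val_ring K \<nu>)" by (rule R.ring_axioms)
  show "subgroup (val_ideal K \<nu>) (add_monoid (val_ring K \<nu>))"
  proof (rule group.subgroupI[OF R.a_group])
    show "val_ideal K \<nu> \<subseteq> carrier (add_monoid (val_ring K \<nu>))"
      by (auto simp: val_ideal_def val_ring_def)
    show "val_ideal K \<nu> \<noteq> {}"
      using abs_zero by (auto simp: val_ideal_def intro: exI[of _ \<zero>])
  next
    fix x assume x: "x \<in> val_ideal K \<nu>"
    then have xR: "x \<in> carrier (val_ring K \<nu>)" by (auto simp: val_ideal_def val_ring_def)
    have "\<ominus>\<^bsub>val_ring K \<nu>\<^esub> x = \<ominus> x"
    proof (rule R.minus_equality)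
      show "\<ominus> x \<oplus>\<^bsub>val_ring K \<nu>\<^esub> x = \<zero>\<^bsub>val_ring K \<nu>\<^esub>"
        using x by (auto simp: val_ideal_def val_ring_def l_neg)
      show "\<ominus> x \<in> carrier (val_ring K \<nu>)"
        using x by (auto simp: val_ideal_def val_ring_def abs_minus)
    qed (rule xR)
    then show "inv\<^bsub>add_monoid (val_ring K \<nu>)\<^esub> x \<in> val_ideal K \<nu>"
      using x by (auto simp: a_inv_def[symmetric] val_ideal_def abs_minus)
  next
    fix x y assume "x \<in> val_ideal K \<nu>" "y \<in> val_ideal K \<nu>"
    then show "x \<otimes>\<^bsub>add_monoid (val_ring K \<nu>)\<^esub> y \<in> val_ideal K \<nu>"
      using abs_ultrametric[of x y] by (auto simp: val_ideal_def val_ring_def)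
  qed
next
  fix a x assume ax: "a \<in> val_ideal K \<nu>" "x \<in> carrier (val_ring K \<nu>)"
  then have a: "a \<in> carrier K" "\<nu> a < 1" and x: "x \<in> carrier K" "\<nu> x \<le> 1"
    by (auto simp: val_ideal_def val_ring_def)
  have "\<nu> x * \<nu> a \<le> 1 * \<nu> a"
    using a x abs_nonneg by (intro mult_right_mono) auto
  then have "\<nu> x * \<nu> a < 1" using a by simp
  then show "x \<otimes>\<^bsub>val_ring K \<nu>\<^esub> a \<in> val_ideal K \<nu>"
    "a \<otimes>\<^bsub>val_ring K \<nu>\<^esub> x \<in> val_ideal K \<nu>"
    using a x by (auto simp: val_ideal_def val_ring_def abs_mult mult.commute)
qed

lemma ideal_not_sub_val_ideal:
  assumes J: "ideal J (val_ring K \<nu>)" and x: "x \<in> J" "x \<notin> val_ideal K \<nu>"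
  shows "J = carrier (val_ring K \<nu>)"
proof -
  interpret J: ideal J "val_ring K \<nu>" by (rule J)
  have xK: "x \<in> carrier K" "\<nu> x = 1"
    using J.Icarr[OF x(1)] x(2) by (auto simp: val_ideal_def val_ring_def)
  then have x0: "x \<noteq> \<zero>" using abs_zero by auto
  have "inv x \<in> carrier (val_ring K \<nu>)"
    using abs_inv[OF xK(1) x0] xK by (auto simp: val_ring_def)
  then have "x \<otimes>\<^bsub>val_ring K \<nu>\<^esub> inv x \<in> J" by (rule J.I_r_closed[OF x(1)])
  then have "\<one>\<^bsub>val_ring K \<nu>\<^esub> \<in> J"
    using abs_inv[OF xK(1) x0] by (simp add: val_ring_def)
  then show ?thesis by (rule J.one_imp_carrier)
qed

lemma val_ideal_proper: "val_ideal K \<nu> \<noteq> carrier (val_ring K \<nu>)"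
proof -
  have "\<one> \<in> carrier (val_ring K \<nu>)" "\<one> \<notin> val_ideal K \<nu>"
    using abs_one by (auto simp: val_ideal_def val_ring_def)
  then show ?thesis by auto
qed

lemma maximalideal_val_ring_iff:
  "maximalideal I (val_ring K \<nu>) \<longleftrightarrow> I = val_ideal K \<nu>"
proof
  assume "maximalideal I (val_ring K \<nu>)"
  then interpret I: maximalideal I "val_ring K \<nu>" .
  have sub: "I \<subseteq> val_ideal K \<nu>"
    using ideal_not_sub_val_ideal[OF I.ideal_axioms] I.I_notcarr by blast
  have "val_ideal K \<nu> \<subseteq> carrier (val_ring K \<nu>)"
    by (auto simp: val_ideal_def val_ring_def)
  from I.I_maximal[OF val_ideal_ideal sub this]
  show "I = val_ideal K \<nu>" using val_ideal_proper by auto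
next
  assume I: "I = val_ideal K \<nu>"
  show "maximalideal I (val_ring K \<nu>)" unfolding I
  proof (rule maximalidealI[OF val_ideal_ideal])
    show "carrier (val_ring K \<nu>) \<noteq> val_ideal K \<nu>" using val_ideal_proper by auto
    show "J = val_ideal K \<nu> \<or> J = carrier (val_ring K \<nu>)"
      if "ideal J (val_ring K \<nu>)" "val_ideal K \<nu> \<subseteq> J" for J
      using ideal_not_sub_val_ideal[OF that(1)] that(2) by blast
  qed
qed

end

section \<open>Ask zeta functions\<close>

definition mats :: "('a, 'b) ring_scheme \<Rightarrow> nat \<Rightarrow> 'a mat set" where
  "mats R d = {A \<in> carrier_mat d d. elements_mat A \<subseteq> carrier R}"

definition diag_mats :: "('a, 'b) ring_scheme \<Rightarrow> nat \<Rightarrow> 'a mat set" where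
  "diag_mats R d = {A \<in> mats R d. \<forall>i<d. \<forall>j<d. i \<noteq> j \<longrightarrow> A $$ (i, j) = \<zero>\<^bsub>R\<^esub>}"

text \<open>
  The multiplication of the matrix library is tied to type classes, so the product of a row
  vector and a matrix over the ring \<open>R\<close> is spelled out here.
\<close>

definition row_mult :: "('a, 'b) ring_scheme \<Rightarrow> 'a vec \<Rightarrow> 'a mat \<Rightarrow> 'a vec" where
  "row_mult R x A =
     vec (dim_col A) (\<lambda>j. \<Oplus>\<^bsub>R\<^esub>i\<in>{..<dim_row A}. vec_index x i \<otimes>\<^bsub>R\<^esub> A $$ (i, j))"

definition row_Ker :: "('a, 'b) ring_scheme \<Rightarrow> nat \<Rightarrow> 'a mat \<Rightarrow> 'a vec set" where
  "row_Ker R d A =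
     {x \<in> carrier_vec d. vec_set x \<subseteq> carrier R \<and> row_mult R x A = vec d (\<lambda>_. \<zero>\<^bsub>R\<^esub>)}"

text \<open>The residue ring modulo the \<open>n\<close>-th power of the ideal \<open>P\<close>; for \<open>n = 0\<close> it is the zero ring.\<close>

definition res_ring :: "('a, 'b) ring_scheme \<Rightarrow> 'a set \<Rightarrow> nat \<Rightarrow> 'a set ring" where
  "res_ring R P n = R Quot (P [^]\<^bsub>ideals_set R\<^esub> n)"

definition red_mat :: "('a, 'b) ring_scheme \<Rightarrow> 'a set \<Rightarrow> nat \<Rightarrow> 'a mat \<Rightarrow> 'a set mat" where
  "red_mat R P n = map_mat (\<lambda>x. (P [^]\<^bsub>ideals_set R\<^esub> n) +>\<^bsub>R\<^esub> x)"

text \<open>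
  \<open>M\<close> is meant to be a submodule of \<open>mats R d\<close>, whose image over the residue ring is
  \<open>red_mat R P n ` M\<close>.
\<close>

definition ask_zeta :: "('a, 'b) ring_scheme \<Rightarrow> 'a set \<Rightarrow> nat \<Rightarrow> 'a mat set \<Rightarrow> rat fps" where
  "ask_zeta R P d M = Abs_fps (\<lambda>n.
     (\<Sum>a\<in>red_mat R P n ` M. of_nat (card (row_Ker (res_ring R P n) d a)))
       / of_nat (card (red_mat R P n ` M)))"

section \<open>Signed permutations\<close>

text \<open>
  Signed permutations are extended to all integers by fixing \<open>0\<close> and everything outside
  \<open>{-n..n}\<close>; the image of \<open>i\<close> under \<open>\<sigma>\<close> is \<open>\<sigma> i\<close>.
\<close>

definition signed_perms :: "nat \<Rightarrow> (int \<Rightarrow> int) set" where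
  "signed_perms n =
     {\<sigma>. \<sigma> permutes ({- int n..int n} - {0}) \<and>
          (\<forall>i\<in>{- int n..int n} - {0}. \<sigma> (- i) = - \<sigma> i)}"

definition neg_count :: "nat \<Rightarrow> (int \<Rightarrow> int) \<Rightarrow> nat" where
  "neg_count n \<sigma> = card {i \<in> {1..int n}. \<sigma> i < 0}"

definition desB :: "nat \<Rightarrow> (int \<Rightarrow> int) \<Rightarrow> nat" where
  "desB n \<sigma> = card {i \<in> {0..<int n}. \<sigma> i > \<sigma> (i + 1)}"

text \<open>The value of the integral bivariate polynomial \<open>h\<^sub>n\<close> at elements of a commutative ring.\<close>

definition h_poly :: "nat \<Rightarrow> 'a::comm_ring_1 \<Rightarrow> 'a \<Rightarrow> 'a" where
  "h_poly n X Y = (\<Sum>\<sigma>\<in>signed_perms n. X ^ neg_count n \<sigma> * Y ^ desB n \<sigma>)"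

end

theory Submission
  imports Defs
begin

text \<open>
  Both sides equal \<open>\<Sum>\<^sub>n (1 + (1 - 1/q) n)\<^sup>d T\<^sup>n\<close>, where \<open>q\<close> is the residue field size.
  Below, \<open>P\<close> is the maximal ideal.

  For the zeta function, the kernel of a diagonal matrix is the product of the annihilators of the
  diagonal entries. So the average kernel size over the residue ring modulo \<open>P\<^sup>n\<close> is the \<open>d\<close>-th power
  of the average size of the annihilator of an element (\<open>average_Ker_diag\<close>). There are
  \<open>q\<^sup>n\<^sup>-\<^sup>i - q\<^sup>n\<^sup>-\<^sup>i\<^sup>-\<^sup>1\<close> elements of valuation \<open>i < n\<close>, each of them is annihilated by the \<open>q\<^sup>i\<close> classes of
  valuation at least \<open>n - i\<close>, and \<open>0\<close> is annihilated by all \<open>q\<^sup>n\<close> classes. The average is therefore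
  \<open>n (1 - 1/q) + 1\<close> (\<open>average_annihilator\<close>).

  For the polynomial, the identity \<open>h\<^sub>d(X, T) = (1 - T)\<^sup>d\<^sup>+\<^sup>1 \<Sum>\<^sub>n (1 + (1 + X) n)\<^sup>d T\<^sup>n\<close> due to Brenti
  (\<open>h_poly_gf\<close>) is applied with \<open>X = -1/q\<close>. It follows by induction on \<open>d\<close>: a signed permutation of
  \<open>d + 1\<close> letters arises from one of \<open>d\<close> letters by inserting \<open>d + 1\<close> or \<open>-(d + 1)\<close> somewhere into its
  word of values. The effect of the insertion on the number of descents depends only on the sign of
  the letter and on whether it enters at a descent, at an ascent or at the end.
\<close>

section \<open>Insertion into signed words\<close>

text \<open>
  A signed permutation is handled as the word of its values at \<open>1, \<dots>, n\<close>. The extra first argument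
  is the letter to the left of the word, so that the recursion can carry it along; for a whole
  word it is \<open>0\<close>, which accounts for a type B descent at position \<open>0\<close>.
\<close>

primrec list_des :: "int \<Rightarrow> int list \<Rightarrow> nat" where
  "list_des a [] = 0"
| "list_des a (b # xs) = of_bool (a > b) + list_des b xs"

definition insert_at :: "nat \<Rightarrow> 'a \<Rightarrow> 'a list \<Rightarrow> 'a list" where
  "insert_at j x xs = take j xs @ x # drop j xs"

lemma insert_at_0 [simp]: "insert_at 0 x xs = x # xs"
  by (simp add: insert_at_def)

lemma insert_at_Suc [simp]: "insert_at (Suc j) x (y # xs) = y # insert_at j x xs"
  by (simp add: insert_at_def)

text \<open>
  A new largest letter put at the end creates no descent. Put between \<open>y\<close> and \<open>z\<close>, it replaces
  that pair by an ascent and a descent, so the number of descents stays when \<open>y > z\<close> and grows by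
  one otherwise. Hence \<open>k + 1\<close> of the positions preserve the number \<open>k\<close> of descents.
\<close>

lemma sum_insert_max:
  fixes t :: "'a::comm_ring_1"
  assumes "a < m" "\<forall>y\<in>set xs. y < m"
  shows "(\<Sum>j\<le>length xs. t ^ list_des a (insert_at j m xs)) =
    (of_nat (list_des a xs) + 1) * t ^ list_des a xs
    + (of_nat (length xs) - of_nat (list_des a xs)) * t ^ Suc (list_des a xs)"
  using assms
proof (induction xs arbitrary: a)
  case Nil
  then show ?case by simp
next
  case (Cons b xs)
  have "(\<Sum>j\<le>length (b # xs). t ^ list_des a (insert_at j m (b # xs))) =
     t ^ Suc (list_des b xs)
     + t ^ of_bool (a > b) * (\<Sum>j\<le>length xs. t ^ list_des b (insert_at j m xs))"
    using Cons.prems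
    by (simp add: sum.atMost_Suc_shift power_add sum_distrib_left del: sum.atMost_Suc)
  also have "\<dots> = t ^ Suc (list_des b xs)
     + t ^ of_bool (a > b) * ((of_nat (list_des b xs) + 1) * t ^ list_des b xs
       + (of_nat (length xs) - of_nat (list_des b xs)) * t ^ Suc (list_des b xs))"
    using Cons by simp
  finally show ?case by (cases "a > b") (simp_all add: algebra_simps del: sum.atMost_Suc)
qed

text \<open>
  The only difference to a largest letter is the end position, where a smallest letter creates a
  descent; so only \<open>k\<close> positions preserve the number \<open>k\<close> of descents.
\<close>

lemma sum_insert_min:
  fixes t :: "'a::comm_ring_1"
  assumes "m < a" "\<forall>y\<in>set xs. m < y"
  shows "(\<Sum>j\<le>length xs. t ^ list_des a (insert_at j m xs)) =
    of_nat (list_des a xs) * t ^ list_des a xs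
    + (of_nat (length xs) + 1 - of_nat (list_des a xs)) * t ^ Suc (list_des a xs)"
  using assms
proof (induction xs arbitrary: a)
  case Nil
  then show ?case by simp
next
  case (Cons b xs)
  have "(\<Sum>j\<le>length (b # xs). t ^ list_des a (insert_at j m (b # xs))) =
     t ^ Suc (list_des b xs)
     + t ^ of_bool (a > b) * (\<Sum>j\<le>length xs. t ^ list_des b (insert_at j m xs))"
    using Cons.prems
    by (simp add: sum.atMost_Suc_shift power_add sum_distrib_left del: sum.atMost_Suc)
  also have "\<dots> = t ^ Suc (list_des b xs)
     + t ^ of_bool (a > b) * (of_nat (list_des b xs) * t ^ list_des b xs
       + (of_nat (length xs) + 1 - of_nat (list_des b xs)) * t ^ Suc (list_des b xs))"
    using Cons by simp
  finally show ?case by (cases "a > b") (simp_all add: algebra_simps del: sum.atMost_Suc)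
qed

definition signed_words :: "nat \<Rightarrow> int list set" where
  "signed_words n = {xs. distinct (map abs xs) \<and> abs ` set xs = {1..int n}}"

lemma signed_words_length: "xs \<in> signed_words n \<Longrightarrow> length xs = n"
  using distinct_card[of "map abs xs"] by (simp add: signed_words_def)

lemma signed_words_0: "signed_words 0 = {[]}"
  by (auto simp: signed_words_def)

lemma signed_words_bounds:
  assumes "xs \<in> signed_words n" "y \<in> set xs"
  shows "y < int (Suc n)" "- int (Suc n) < y" "\<bar>y\<bar> < int (Suc n)"
proof -
  have "\<bar>y\<bar> \<in> {1..int n}" using assms by (auto simp: signed_words_def)
  then show "y < int (Suc n)" "- int (Suc n) < y" "\<bar>y\<bar> < int (Suc n)" by auto
qed

lemma insert_at_in_signed_words:
  assumes xs: "xs \<in> signed_words n" and x: "\<bar>x\<bar> = int (Suc n)"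
  shows "insert_at j x xs \<in> signed_words (Suc n)"
proof -
  have m: "mset (insert_at j x xs) = mset (x # xs)"
    by (simp add: insert_at_def) (metis append_take_drop_id mset_append)
  have "distinct (map abs (x # xs))"
    using xs signed_words_bounds(3)[OF xs] x by (force simp: signed_words_def)
  then have "distinct (map abs (insert_at j x xs))"
    by (metis m mset_map distinct_count_atmost_1 mset_eq_imp_distinct_iff)
  moreover have "abs ` set (insert_at j x xs) = insert \<bar>x\<bar> (abs ` set xs)"
    by (metis m mset_eq_setD image_insert list.simps(15))
  ultimately show ?thesis
    using xs x by (auto simp: signed_words_def)
qed

text \<open>
  The letter of largest absolute value can be located in any word and deleted, so every word
  arises exactly once by an insertion.
\<close>

lemma sum_signed_words_Suc:
  "sum f (signed_words (Suc n)) =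
   (\<Sum>xs\<in>signed_words n. \<Sum>x\<in>{int (Suc n), - int (Suc n)}. \<Sum>j\<le>n. f (insert_at j x xs))"
proof -
  let ?N = "int (Suc n)"
  let ?low = "\<lambda>y::int. \<bar>y\<bar> \<noteq> ?N"
  \<comment> \<open>the position of the new letter is read off as the length of this prefix\<close>
  have tw: "takeWhile ?low (insert_at j x xs) = take j xs"
    if "xs \<in> signed_words n" "\<bar>x\<bar> = ?N" for xs j x
  proof -
    have "\<forall>y\<in>set (take j xs). ?low y"
      using signed_words_bounds(3)[OF that(1)] by (metis in_set_takeD less_irrefl)
    then show ?thesis using that by (simp add: insert_at_def takeWhile_append2)
  qed
  have dec: "\<exists>j\<le>n. \<exists>x. \<exists>ys\<in>signed_words n. \<bar>x\<bar> = ?N \<and> zs = insert_at j x ys"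
    if zs: "zs \<in> signed_words (Suc n)" for zs
  proof -
    have "?N \<in> abs ` set zs" using zs by (auto simp: signed_words_def)
    then obtain x where x: "x \<in> set zs" "\<bar>x\<bar> = ?N" by auto
    then obtain us vs where z: "zs = us @ x # vs" by (meson split_list)
    have d: "distinct (map abs zs)" and s: "abs ` set zs = {1..?N}"
      using zs by (auto simp: signed_words_def)
    have "?N \<notin> abs ` set (us @ vs)" using d x by (auto simp: z)
    moreover have "insert ?N (abs ` set (us @ vs)) = {1..?N}" using s x by (auto simp: z)
    ultimately have "abs ` set (us @ vs) = {1..?N} - {?N}" by blast
    also have "\<dots> = {1..int n}" by auto
    finally have w: "us @ vs \<in> signed_words n"
      using d by (auto simp: signed_words_def z)
    have "length us \<le> n" using signed_words_length[OF w] by simp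
    then show ?thesis using w x z
      by (intro exI[of _ "length us"] conjI exI[of _ x] bexI[of _ "us @ vs"])
        (auto simp: insert_at_def)
  qed
  have "sum f (signed_words (Suc n)) =
     (\<Sum>(xs, x, j)\<in>signed_words n \<times> {?N, - ?N} \<times> {..n}. f (insert_at j x xs))"
  proof -
    let ?D = "signed_words n \<times> {?N, - ?N} \<times> {..n}" and ?h = "\<lambda>(xs, x, j). insert_at j x xs"
    have "bij_betw ?h ?D (signed_words (Suc n))"
      unfolding bij_betw_def
    proof
      show "inj_on ?h ?D"
      proof (rule inj_onI)
        fix p p' assume p: "p \<in> ?D" "p' \<in> ?D" "?h p = ?h p'"
        obtain xs x j xs' x' j' where pp: "p = (xs, x, j)" "p' = (xs', x', j')"
          by (cases p, cases p')
        have xs: "xs \<in> signed_words n" "xs' \<in> signed_words n"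
          and x: "x \<in> {?N, - ?N}" "x' \<in> {?N, - ?N}" and j: "j \<in> {..n}" "j' \<in> {..n}"
          and eq: "insert_at j x xs = insert_at j' x' xs'"
          using p by (simp_all add: pp)
        have t: "take j xs = take j' xs'"
          using tw[OF xs(1), of x j] tw[OF xs(2), of x' j'] x eq by auto
        with j have "j = j'"
          using signed_words_length[OF xs(1)] signed_words_length[OF xs(2)]
          by (metis atMost_iff length_take min.absorb2)
        moreover have "x # drop j xs = x' # drop j' xs'"
          using eq t by (simp add: insert_at_def)
        ultimately show "p = p'"
          using t unfolding pp by (metis append_take_drop_id list.inject)
      qed
      have "\<exists>p\<in>?D. zs = ?h p" if zs: "zs \<in> signed_words (Suc n)" for zs
      proof -
        obtain j x ys where "j \<le> n" "ys \<in> signed_words n" "\<bar>x\<bar> = ?N" "zs = insert_at j x ys"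
          using dec[OF zs] by blast
        then show ?thesis by (intro bexI[of _ "(ys, x, j)"]) auto
      qed
      moreover have "?h p \<in> signed_words (Suc n)" if "p \<in> ?D" for p
        using that insert_at_in_signed_words by auto
      ultimately show "?h ` ?D = signed_words (Suc n)" by blast
    qed
    from sum.reindex_bij_betw[OF this, of f] show ?thesis
      by (simp add: case_prod_unfold)
  qed
  then show ?thesis by (simp add: sum.cartesian_product)
qed

text \<open>
  The positive letter contributes \<open>k + 1\<close> and the negative one, with weight \<open>X\<close>, contributes \<open>k\<close>
  positions that preserve the number \<open>k\<close> of descents. These add up to \<open>(1 + X) k + 1\<close> of the total
  weight \<open>(1 + X) (n + 1)\<close> of all insertions.
\<close>

lemma sum_signed_words_Suc_des:
  fixes X t :: "'a::comm_ring_1"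
  defines "neg \<equiv> \<lambda>xs. length (filter (\<lambda>y. y < (0::int)) xs)"
  shows "(\<Sum>zs\<in>signed_words (Suc n). X ^ neg zs * t ^ list_des 0 zs) =
    (\<Sum>xs\<in>signed_words n. X ^ neg xs * ((1 + X) * of_nat (list_des 0 xs) + 1) * t ^ list_des 0 xs
     + X ^ neg xs * ((1 + X) * (of_nat n + 1 - of_nat (list_des 0 xs)) - 1) * t ^ Suc (list_des 0 xs))"
proof -
  have ni: "neg (insert_at j x xs) = of_bool (x < 0) + neg xs" for j x xs
  proof -
    have "neg xs = neg (take j xs @ drop j xs)" by simp
    then show ?thesis unfolding insert_at_def neg_def filter_append length_append by simp
  qed
  have "(\<Sum>x\<in>{int (Suc n), - int (Suc n)}. \<Sum>j\<le>n.
          X ^ neg (insert_at j x xs) * t ^ list_des 0 (insert_at j x xs)) =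
     X ^ neg xs * ((1 + X) * of_nat (list_des 0 xs) + 1) * t ^ list_des 0 xs
     + X ^ neg xs * ((1 + X) * (of_nat n + 1 - of_nat (list_des 0 xs)) - 1) * t ^ Suc (list_des 0 xs)"
    if xs: "xs \<in> signed_words n" for xs
  proof -
    have l: "length xs = n" by (rule signed_words_length[OF xs])
    have "(\<Sum>x\<in>{int (Suc n), - int (Suc n)}. \<Sum>j\<le>n.
          X ^ neg (insert_at j x xs) * t ^ list_des 0 (insert_at j x xs)) =
        X ^ neg xs * (\<Sum>j\<le>length xs. t ^ list_des 0 (insert_at j (int (Suc n)) xs))
        + X ^ Suc (neg xs) * (\<Sum>j\<le>length xs. t ^ list_des 0 (insert_at j (- int (Suc n)) xs))"
      by (simp add: ni sum_distrib_left l)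
    also have "(\<Sum>j\<le>length xs. t ^ list_des 0 (insert_at j (int (Suc n)) xs)) =
        (of_nat (list_des 0 xs) + 1) * t ^ list_des 0 xs
        + (of_nat (length xs) - of_nat (list_des 0 xs)) * t ^ Suc (list_des 0 xs)"
      using signed_words_bounds[OF xs] by (intro sum_insert_max) auto
    also have "(\<Sum>j\<le>length xs. t ^ list_des 0 (insert_at j (- int (Suc n)) xs)) =
        of_nat (list_des 0 xs) * t ^ list_des 0 xs
        + (of_nat (length xs) + 1 - of_nat (list_des 0 xs)) * t ^ Suc (list_des 0 xs)"
      using signed_words_bounds[OF xs] by (intro sum_insert_min) auto
    finally show ?thesis by (simp add: l algebra_simps)
  qed
  then show ?thesis unfolding sum_signed_words_Suc by (intro sum.cong refl) 
qed

section \<open>The generating function of signed words\<close>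

text \<open>
  With \<open>G\<close> for the sum over words and \<open>F\<close> for the power series on the right, the insertion recurrence is
  the differential recurrence
  \<open>G\<^sub>n\<^sub>+\<^sub>1 = (1 + X) (t (1 - t) G\<^sub>n' + (n + 1) t G\<^sub>n) + (1 - t) G\<^sub>n\<close>, because \<open>t d/dt\<close> multiplies
  \<open>t\<^sup>k\<close> by \<open>k\<close>. On coefficients, \<open>F\<^sub>n\<^sub>+\<^sub>1 = F\<^sub>n + (1 + X) t F\<^sub>n'\<close> is one more factor
  \<open>1 + (1 + X) m\<close>. The substitution \<open>G\<^sub>n = F\<^sub>n (1 - t)\<^sup>n\<^sup>+\<^sup>1\<close> turns one recurrence into the other.
\<close>

lemma signed_words_gf:
  fixes x :: "'a::field_char_0"
  shows "(\<Sum>xs\<in>signed_words n. fps_const x ^ length (filter (\<lambda>y. y < 0) xs) * fps_X ^ list_des 0 xs)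
     = Abs_fps (\<lambda>m. (1 + (1 + x) * of_nat m) ^ n) * (1 - fps_X) ^ Suc n"
    (is "?G n = ?F n * _")
proof (induction n)
  case 0
  have "Abs_fps (\<lambda>_. 1::'a) * (1 - fps_X) = 1"
    by (rule fps_ext) (simp add: algebra_simps)
  then show ?case by (simp add: signed_words_0)
next
  case (Suc n)
  let ?t = "fps_X :: 'a fps" and ?X = "fps_const x"
  let ?neg = "\<lambda>xs. length (filter (\<lambda>y. y < (0::int)) xs)"
  have F: "?F (Suc n) = ?F n + (1 + ?X) * (?t * fps_deriv (?F n))"
  proof (rule fps_ext)
    fix m
    have c: "1 + ?X = fps_const (1 + x)" by (metis fps_const_1_eq_1 fps_const_add)
    show "fps_nth (?F (Suc n)) m = fps_nth (?F n + (1 + ?X) * (?t * fps_deriv (?F n))) m"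
      unfolding c by (cases m) (simp_all add: algebra_simps)
  qed
  have td: "?t * fps_deriv (?t ^ k) = of_nat k * ?t ^ k" for k
    unfolding fps_deriv_power by (cases k) (simp_all only: fps_of_nat fps_deriv_fps_X diff_Suc_1 power_Suc mult_ac mult_1 of_nat_0 mult_zero_left mult_zero_right fps_const_0_eq_0)
  have tG: "?t * fps_deriv (?G n) =
      (\<Sum>xs\<in>signed_words n. ?X ^ ?neg xs * of_nat (list_des 0 xs) * ?t ^ list_des 0 xs)"
  proof -
    have "?t * fps_deriv (?X ^ i * ?t ^ k) = ?X ^ i * of_nat k * ?t ^ k" for i k
    proof -
      have "fps_deriv (?X ^ i * ?t ^ k) = ?X ^ i * fps_deriv (?t ^ k)"
        unfolding fps_const_power by (rule fps_deriv_mult_const_left)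
      then show ?thesis using td[of k] by (metis mult.assoc mult.left_commute)
    qed
    then show ?thesis by (simp only: fps_deriv_sum sum_distrib_left)
  qed
  have "?G (Suc n) = (1 + ?X) * (1 - ?t) * (?t * fps_deriv (?G n))
     + (1 + ?X) * of_nat (Suc n) * ?t * ?G n + (1 - ?t) * ?G n"
    unfolding sum_signed_words_Suc_des tG sum_distrib_left sum.distrib[symmetric]
    by (intro sum.cong refl) (simp add: algebra_simps del: fps_const_power fps_const_mult fps_const_add)
  also have "fps_deriv (?G n) =
     fps_deriv (?F n) * (1 - ?t) ^ Suc n - of_nat (Suc n) * ?F n * (1 - ?t) ^ n"
  proof -
    have d: "fps_deriv ((1 - ?t) ^ Suc n) = - (of_nat (Suc n) * (1 - ?t) ^ n)"
      unfolding fps_deriv_power fps_of_nat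
      by (simp only: fps_deriv_sub fps_deriv_1 fps_deriv_fps_X diff_Suc_1)
        (simp only: algebra_simps mult_1_right mult_minus_right mult_zero_right diff_0
          mult_minus_left mult_1_left)
    have "a * (- (k * b)) + e = e - k * a * b" for a b e k :: "'a fps"
      by (simp add: algebra_simps)
    then show ?thesis unfolding Suc.IH fps_deriv_mult d .
  qed
  also have "(1 + ?X) * (1 - ?t) * (?t * \<dots>) + (1 + ?X) * of_nat (Suc n) * ?t * ?G n + (1 - ?t) * ?G n
     = (?F n + (1 + ?X) * (?t * fps_deriv (?F n))) * (1 - ?t) ^ Suc (Suc n)"
    unfolding Suc.IH by (simp add: algebra_simps)
  finally show ?case unfolding F .
qed


section \<open>Signed permutations as words\<close>

lemma list_des_card: "list_des a xs = card {i. i < length xs \<and> (a # xs) ! i > xs ! i}"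
proof (induction xs arbitrary: a)
  case Nil
  then show ?case by simp
next
  case (Cons b xs)
  have "{i. i < length (b # xs) \<and> (a # b # xs) ! i > (b # xs) ! i} =
     (if a > b then {0} else {}) \<union> Suc ` {i. i < length xs \<and> (b # xs) ! i > xs ! i}"
    (is "?L = ?A \<union> Suc ` ?B")
  proof (rule Set.set_eqI)
    fix i show "i \<in> ?L \<longleftrightarrow> i \<in> ?A \<union> Suc ` ?B" by (cases i) auto
  qed
  moreover have "card (?A \<union> Suc ` ?B) = card ?A + card ?B"
    by (subst card_Un_disjoint) (auto simp: card_image)
  ultimately show ?case by (simp add: Cons.IH)
qed

definition word_of :: "nat \<Rightarrow> (int \<Rightarrow> int) \<Rightarrow> int list" where
  "word_of n \<sigma> = map (\<lambda>i. \<sigma> (int i + 1)) [0..<n]"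

lemma neg_count_word: "neg_count n \<sigma> = length (filter (\<lambda>y. y < 0) (word_of n \<sigma>))"
proof -
  have "{i \<in> {1..int n}. \<sigma> i < 0} = (\<lambda>i. int i + 1) ` {i. i < n \<and> \<sigma> (int i + 1) < 0}"
  proof (intro Set.set_eqI iffI)
    fix i assume "i \<in> {i \<in> {1..int n}. \<sigma> i < 0}"
    then show "i \<in> (\<lambda>i. int i + 1) ` {i. i < n \<and> \<sigma> (int i + 1) < 0}"
      by (intro image_eqI[of _ _ "nat (i - 1)"]) auto
  qed auto
  then have "neg_count n \<sigma> = card {i. i < n \<and> \<sigma> (int i + 1) < 0}"
    by (simp add: neg_count_def card_image inj_on_def)
  also have "\<dots> = length (filter (\<lambda>y. y < 0) (word_of n \<sigma>))"
    unfolding length_filter_conv_card word_of_def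
    by (intro arg_cong[of _ _ card]) auto
  finally show ?thesis .
qed

lemma desB_word:
  assumes "\<sigma> 0 = 0"
  shows "desB n \<sigma> = list_des 0 (word_of n \<sigma>)"
proof -
  have "{i \<in> {0..<int n}. \<sigma> i > \<sigma> (i + 1)} = int ` {i. i < n \<and> \<sigma> (int i) > \<sigma> (int i + 1)}"
  proof (intro Set.set_eqI iffI)
    fix i assume "i \<in> {i \<in> {0..<int n}. \<sigma> i > \<sigma> (i + 1)}"
    then show "i \<in> int ` {i. i < n \<and> \<sigma> (int i) > \<sigma> (int i + 1)}"
      by (intro image_eqI[of _ _ "nat i"]) auto
  qed auto
  then have "desB n \<sigma> = card {i. i < n \<and> \<sigma> (int i) > \<sigma> (int i + 1)}"
    by (simp add: desB_def card_image inj_on_def)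
  also have "\<dots> = list_des 0 (word_of n \<sigma>)"
    unfolding list_des_card
  proof (intro arg_cong[of _ _ card] Collect_cong conj_cong)
    fix i assume "i < length (word_of n \<sigma>)"
    then show "(\<sigma> (int i) > \<sigma> (int i + 1)) = ((0 # word_of n \<sigma>) ! i > word_of n \<sigma> ! i)"
      using assms by (cases i) (auto simp: word_of_def add.commute)
  qed (auto simp: word_of_def)
  finally show ?thesis .
qed

text \<open>
  Oddness recovers the values at negative arguments from the word, and the values outside
  \<open>{-n..n} - {0}\<close> are fixed.
\<close>

lemma word_of_bij: "bij_betw (word_of n) (signed_perms n) (signed_words n)"
proof -
  let ?U = "{- int n..int n} - {0}"
  have mem: "word_of n \<sigma> \<in> signed_words n" if s: "\<sigma> \<in> signed_perms n" for \<sigma>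
  proof -
    have p: "\<sigma> permutes ?U" and o: "\<And>i. i \<in> ?U \<Longrightarrow> \<sigma> (- i) = - \<sigma> i"
      using s by (auto simp: signed_perms_def)
    have inj: "inj_on (\<lambda>i. \<bar>\<sigma> i\<bar>) {1..int n}"
    proof (rule inj_onI)
      fix i j assume ij: "i \<in> {1..int n}" "j \<in> {1..int n}" "\<bar>\<sigma> i\<bar> = \<bar>\<sigma> j\<bar>"
      then have "\<sigma> i = \<sigma> j \<or> \<sigma> i = \<sigma> (- j)" using o[of j] by (auto simp: abs_eq_iff)
      then have "i = j \<or> i = - j" using permutes_inj[OF p] by (auto dest: injD)
      then show "i = j" using ij by auto
    qed
    have img: "(\<lambda>i. \<bar>\<sigma> i\<bar>) ` {1..int n} \<subseteq> {1..int n}"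
    proof
      fix y assume "y \<in> (\<lambda>i. \<bar>\<sigma> i\<bar>) ` {1..int n}"
      then obtain i where i: "i \<in> {1..int n}" "y = \<bar>\<sigma> i\<bar>" by auto
      have "\<sigma> i \<in> ?U" using permutes_in_image[OF p, of i] i by auto
      then show "y \<in> {1..int n}" using i by auto
    qed
    have im: "(\<lambda>i. \<bar>\<sigma> i\<bar>) ` {1..int n} = {1..int n}"
      using endo_inj_surj[OF _ img inj] by simp
    have r: "(\<lambda>i. int i + 1) ` {0..<n} = {1..int n}"
    proof (intro Set.set_eqI iffI)
      fix i assume "i \<in> {1..int n}"
      then show "i \<in> (\<lambda>i. int i + 1) ` {0..<n}"
        by (intro image_eqI[of _ _ "nat (i - 1)"]) auto
    qed auto
    have "abs ` set (word_of n \<sigma>) = (\<lambda>i. \<bar>\<sigma> i\<bar>) ` (\<lambda>i. int i + 1) ` {0..<n}"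
      by (simp add: word_of_def image_image)
    moreover have "distinct (map abs (word_of n \<sigma>))"
    proof -
      have "inj_on (\<lambda>i. \<bar>\<sigma> (int i + 1)\<bar>) {0..<n}"
      proof (rule inj_onI)
        fix i j assume "i \<in> {0..<n}" "j \<in> {0..<n}" "\<bar>\<sigma> (int i + 1)\<bar> = \<bar>\<sigma> (int j + 1)\<bar>"
        then show "i = j" using inj_onD[OF inj, of "int i + 1" "int j + 1"] by simp
      qed
      then show ?thesis by (simp add: word_of_def distinct_map o_def)
    qed
    ultimately show ?thesis by (simp add: signed_words_def r im)
  qed
  have inj: "inj_on (word_of n) (signed_perms n)"
  proof (rule inj_onI)
    fix \<sigma> \<tau> assume s: "\<sigma> \<in> signed_perms n" "\<tau> \<in> signed_perms n" and e: "word_of n \<sigma> = word_of n \<tau>"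
    have pos: "\<sigma> i = \<tau> i" if "i \<in> {1..int n}" for i
    proof -
      have "word_of n \<sigma> ! nat (i - 1) = word_of n \<tau> ! nat (i - 1)" using e by simp
      then show ?thesis using that by (auto simp: word_of_def)
    qed
    show "\<sigma> = \<tau>"
    proof
      fix i
      consider "i \<in> {1..int n}" | "- i \<in> {1..int n}" | "i \<notin> ?U" by fastforce
      then show "\<sigma> i = \<tau> i"
      proof cases
        case 2
        then have "\<sigma> (- (- i)) = - \<sigma> (- i)" "\<tau> (- (- i)) = - \<tau> (- i)"
          using s unfolding signed_perms_def by (auto simp del: minus_minus)
        then show ?thesis using pos[OF 2] by simp
      next
        case 3
        then show ?thesis using s by (auto simp: signed_perms_def permutes_def)
      qed (rule pos)
    qed
  qed
  have sur: "\<exists>\<sigma>\<in>signed_perms n. word_of n \<sigma> = xs" if xs: "xs \<in> signed_words n" for xs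
  proof -
    have l: "length xs = n" by (rule signed_words_length[OF xs])
    have d: "distinct (map abs xs)" and im: "abs ` set xs = {1..int n}"
      using xs by (auto simp: signed_words_def)
    define \<sigma> where "\<sigma> i = (if i \<in> ?U then sgn i * xs ! nat (\<bar>i\<bar> - 1) else i)" for i
    have ab: "\<bar>\<sigma> i\<bar> = map abs xs ! nat (\<bar>i\<bar> - 1)" and ln: "nat (\<bar>i\<bar> - 1) < n"
      if "i \<in> ?U" for i
      using that l by (auto simp: \<sigma>_def abs_mult)
    have r: "map abs xs ! k \<in> {1..int n}" if "k < n" for k
      using that l im by (metis (no_types) length_map list.set_map nth_mem)
    have maps: "\<sigma> i \<in> ?U" if "i \<in> ?U" for i
      using ab[OF that] r[OF ln[OF that]] by auto
    have injU: "inj_on \<sigma> ?U"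
    proof (rule inj_onI)
      fix i j assume i: "i \<in> ?U" and j: "j \<in> ?U" and e: "\<sigma> i = \<sigma> j"
      have "map abs xs ! nat (\<bar>i\<bar> - 1) = map abs xs ! nat (\<bar>j\<bar> - 1)"
        using ab[OF i] ab[OF j] e by simp
      then have "nat (\<bar>i\<bar> - 1) = nat (\<bar>j\<bar> - 1)"
        using nth_eq_iff_index_eq[OF d] ln[OF i] ln[OF j] l by simp
      moreover from this have "sgn i = sgn j"
        using e maps[OF i] i j by (auto simp: \<sigma>_def)
      ultimately show "i = j" using i j by (auto simp: sgn_if split: if_splits)
    qed
    have "\<sigma> ` ?U = ?U"
      using maps by (intro endo_inj_surj[OF _ _ injU]) auto
    then have "\<sigma> permutes ?U"
      using injU by (intro bij_imp_permutes) (auto simp: bij_betw_def \<sigma>_def)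
    moreover have "\<sigma> (- i) = - \<sigma> i" if "i \<in> ?U" for i
      using that by (auto simp: \<sigma>_def)
    ultimately have "\<sigma> \<in> signed_perms n" by (simp add: signed_perms_def)
    moreover have "word_of n \<sigma> = xs"
      by (rule nth_equalityI) (auto simp: word_of_def \<sigma>_def l)
    ultimately show ?thesis by blast
  qed
  show ?thesis
    unfolding bij_betw_def using inj mem sur by blast
qed

text \<open>
  This is Brenti's type B analogue of the Carlitz identity, in which the sign changes are weighted
  by \<open>x\<close>.
\<close>

lemma h_poly_gf:
  fixes x :: "'a::field_char_0"
  shows "h_poly n (fps_const x) fps_X
     = Abs_fps (\<lambda>m. (1 + (1 + x) * of_nat m) ^ n) * (1 - fps_X) ^ (n + 1)"
proof -
  have z: "\<sigma> 0 = 0" if "\<sigma> \<in> signed_perms n" for \<sigma>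
    using that by (auto simp: signed_perms_def permutes_def)
  have "h_poly n (fps_const x) fps_X =
     (\<Sum>\<sigma>\<in>signed_perms n. fps_const x ^ length (filter (\<lambda>y. y < 0) (word_of n \<sigma>))
        * fps_X ^ list_des 0 (word_of n \<sigma>))"
    unfolding h_poly_def by (intro sum.cong refl) (simp add: neg_count_word desB_word z)
  also have "\<dots> = (\<Sum>xs\<in>signed_words n.
      fps_const x ^ length (filter (\<lambda>y. y < 0) xs) * fps_X ^ list_des 0 xs)"
    by (rule sum.reindex_bij_betw[OF word_of_bij])
  finally show ?thesis using signed_words_gf[of x n] by simp
qed

section \<open>Kernels of diagonal matrices over a finite commutative ring\<close>

definition diag_of :: "('a, 'b) ring_scheme \<Rightarrow> nat \<Rightarrow> (nat \<Rightarrow> 'a) \<Rightarrow> 'a mat" where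
  "diag_of R d f = mat d d (\<lambda>(i, j). if i = j then f i else \<zero>\<^bsub>R\<^esub>)"

definition annihilator :: "('a, 'b) ring_scheme \<Rightarrow> 'a \<Rightarrow> 'a set" where
  "annihilator R a = {x \<in> carrier R. a \<otimes>\<^bsub>R\<^esub> x = \<zero>\<^bsub>R\<^esub>}"

lemma diag_mats_iff:
  "A \<in> diag_mats R d \<longleftrightarrow> A \<in> carrier_mat d d \<and>
    (\<forall>i<d. \<forall>j<d. A $$ (i, j) \<in> carrier R \<and> (i \<noteq> j \<longrightarrow> A $$ (i, j) = \<zero>\<^bsub>R\<^esub>))"
proof -
  have "elements_mat A \<subseteq> carrier R \<longleftrightarrow> (\<forall>i<d. \<forall>j<d. A $$ (i, j) \<in> carrier R)"
    if "A \<in> carrier_mat d d"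
    using that by (auto simp: elements_mat_def UN_subset_iff image_subset_iff)
  then show ?thesis by (auto simp: diag_mats_def mats_def)
qed

lemma (in cring) diag_of_bij:
  "bij_betw (diag_of R d) ({..<d} \<rightarrow>\<^sub>E carrier R) (diag_mats R d)"
proof (rule bij_betw_byWitness[where f' = "\<lambda>A. restrict (\<lambda>i. A $$ (i, i)) {..<d}"])
  show "\<forall>f\<in>{..<d} \<rightarrow>\<^sub>E carrier R. restrict (\<lambda>i. diag_of R d f $$ (i, i)) {..<d} = f"
    by (auto simp: diag_of_def restrict_def PiE_def extensional_def)
  show "\<forall>A\<in>diag_mats R d. diag_of R d (restrict (\<lambda>i. A $$ (i, i)) {..<d}) = A"
    by (auto simp: diag_of_def diag_mats_iff intro!: eq_matI)
  show "diag_of R d ` ({..<d} \<rightarrow>\<^sub>E carrier R) \<subseteq> diag_mats R d"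
    unfolding image_subset_iff diag_mats_iff by (simp add: diag_of_def PiE_iff)
  show "(\<lambda>A. restrict (\<lambda>i. A $$ (i, i)) {..<d}) ` diag_mats R d \<subseteq> {..<d} \<rightarrow>\<^sub>E carrier R"
    unfolding image_subset_iff by (simp add: diag_mats_iff PiE_iff)
qed

lemma (in cring) row_mult_diag_of:
  assumes f: "f \<in> {..<d} \<rightarrow> carrier R" and x: "x \<in> carrier_vec d" "vec_set x \<subseteq> carrier R"
  shows "row_mult R x (diag_of R d f) = vec d (\<lambda>i. f i \<otimes> vec_index x i)"
proof (rule eq_vecI)
  have xc: "vec_index x i \<in> carrier R" if "i < d" for i
    using x that by (auto simp: vec_set_def)
  show "dim_vec (row_mult R x (diag_of R d f)) = dim_vec (vec d (\<lambda>i. f i \<otimes> vec_index x i))"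
    by (simp add: row_mult_def diag_of_def)
  fix j assume "j < dim_vec (vec d (\<lambda>i. f i \<otimes> vec_index x i))"
  then have j: "j < d" by simp
  have "(\<Oplus>i\<in>{..<d}. vec_index x i \<otimes> diag_of R d f $$ (i, j)) =
      (\<Oplus>i\<in>{..<d}. if j = i then vec_index x i \<otimes> f i else \<zero>)"
    using j xc f by (intro finsum_cong') (auto simp: diag_of_def Pi_iff)
  also have "\<dots> = vec_index x j \<otimes> f j"
    using j xc f by (intro add.finprod_singleton) (auto simp: Pi_iff)
  also have "\<dots> = f j \<otimes> vec_index x j"
    using j xc f by (intro m_comm) auto
  finally show "vec_index (row_mult R x (diag_of R d f)) j
      = vec_index (vec d (\<lambda>i. f i \<otimes> vec_index x i)) j"
    using j by (simp add: row_mult_def diag_of_def)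
qed

lemma (in cring) card_row_Ker_diag_of:
  assumes f: "f \<in> {..<d} \<rightarrow> carrier R"
  shows "card (row_Ker R d (diag_of R d f)) = (\<Prod>i<d. card (annihilator R (f i)))"
proof -
  have iff: "x \<in> row_Ker R d (diag_of R d f) \<longleftrightarrow>
      x \<in> carrier_vec d \<and> (\<forall>i<d. vec_index x i \<in> annihilator R (f i))" for x
  proof -
    have "row_mult R x (diag_of R d f) = vec d (\<lambda>_. \<zero>) \<longleftrightarrow> (\<forall>i<d. f i \<otimes> vec_index x i = \<zero>)"
      if "x \<in> carrier_vec d" "vec_set x \<subseteq> carrier R"
      using row_mult_diag_of[OF f that] by (simp add: vec_eq_iff)
    then show ?thesis
      by (auto simp: row_Ker_def annihilator_def vec_set_def)
  qed
  have "bij_betw (vec d) (\<Pi>\<^sub>E i\<in>{..<d}. annihilator R (f i)) (row_Ker R d (diag_of R d f))"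
  proof (rule bij_betw_byWitness[where f' = "\<lambda>x. restrict (vec_index x) {..<d}"])
    show "\<forall>g\<in>(\<Pi>\<^sub>E i\<in>{..<d}. annihilator R (f i)). restrict (vec_index (vec d g)) {..<d} = g"
      by (auto simp: restrict_def PiE_def extensional_def)
    show "\<forall>x\<in>row_Ker R d (diag_of R d f). vec d (restrict (vec_index x) {..<d}) = x"
      by (intro ballI eq_vecI) (auto simp: iff)
    show "vec d ` (\<Pi>\<^sub>E i\<in>{..<d}. annihilator R (f i)) \<subseteq> row_Ker R d (diag_of R d f)"
      by (auto simp: iff PiE_def Pi_iff)
    show "(\<lambda>x. restrict (vec_index x) {..<d}) ` row_Ker R d (diag_of R d f)
        \<subseteq> (\<Pi>\<^sub>E i\<in>{..<d}. annihilator R (f i))"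
      unfolding image_subset_iff by (simp add: iff PiE_iff)
  qed
  then show ?thesis using card_PiE[of "{..<d}"] by (simp add: bij_betw_same_card[symmetric])
qed

text \<open>
  The kernel of a diagonal matrix is the product of the annihilators of its diagonal entries, and
  these entries vary independently. Hence the average is multiplicative in the entries.
\<close>

lemma (in cring) average_Ker_diag:
  assumes "finite (carrier R)"
  shows "(\<Sum>A\<in>diag_mats R d. of_nat (card (row_Ker R d A))) / of_nat (card (diag_mats R d))
     = ((\<Sum>a\<in>carrier R. of_nat (card (annihilator R a))) / of_nat (card (carrier R)) :: rat) ^ d"
proof -
  have "(\<Sum>A\<in>diag_mats R d. of_nat (card (row_Ker R d A))) =
      (\<Sum>f\<in>{..<d} \<rightarrow>\<^sub>E carrier R. of_nat (card (row_Ker R d (diag_of R d f))) :: rat)"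
    by (rule sum.reindex_bij_betw[OF diag_of_bij, symmetric])
  also have "\<dots> = (\<Sum>f\<in>{..<d} \<rightarrow>\<^sub>E carrier R. \<Prod>i<d. of_nat (card (annihilator R (f i))))"
    by (intro sum.cong refl) (subst card_row_Ker_diag_of, auto simp: PiE_def)
  also have "\<dots> = (\<Prod>i<d. \<Sum>a\<in>carrier R. of_nat (card (annihilator R a)))"
    using assms by (intro prod_sum_PiE[symmetric]) auto
  finally show ?thesis
    using bij_betw_same_card[OF diag_of_bij[of d]]
    by (simp add: card_PiE power_divide flip: bij_betw_same_card[OF diag_of_bij[of d]])
qed

lemma red_mat_diag_mats:
  assumes "ideal (P [^]\<^bsub>ideals_set R\<^esub> n) R"
  shows "red_mat R P n ` diag_mats R d = diag_mats (res_ring R P n) d"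
proof -
  interpret I: ideal "P [^]\<^bsub>ideals_set R\<^esub> n" R by (rule assms)
  let ?I = "P [^]\<^bsub>ideals_set R\<^esub> n"
  have c: "carrier (res_ring R P n) = (+>\<^bsub>R\<^esub>) ?I ` carrier R"
    by (auto simp: res_ring_def FactRing_def A_RCOSETS_def')
  have z: "?I +>\<^bsub>R\<^esub> \<zero>\<^bsub>R\<^esub> = \<zero>\<^bsub>res_ring R P n\<^esub>"
    by (simp add: res_ring_def FactRing_def I.a_rcos_const)
  show ?thesis
  proof (intro Set.set_eqI iffI)
    fix B assume "B \<in> red_mat R P n ` diag_mats R d"
    then show "B \<in> diag_mats (res_ring R P n) d"
      by (auto simp: red_mat_def diag_mats_iff c z)
  next
    fix B assume B: "B \<in> diag_mats (res_ring R P n) d"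
    have "\<exists>x\<in>carrier R. B $$ (i, i) = ?I +>\<^bsub>R\<^esub> x" if "i < d" for i
    proof -
      have "B $$ (i, i) \<in> carrier (res_ring R P n)"
        using B that by (simp add: diag_mats_iff)
      then show ?thesis by (auto simp: c)
    qed
    then obtain f where f: "f i \<in> carrier R" "B $$ (i, i) = ?I +>\<^bsub>R\<^esub> f i" if "i < d" for i
      by (metis (no_types))
    have "diag_of R d f \<in> diag_mats R d"
      using f ring.ring_simprules(2)[OF I.ring_axioms] by (auto simp: diag_of_def diag_mats_iff)
    moreover have "B = red_mat R P n (diag_of R d f)"
      using B f z by (intro eq_matI) (auto simp: red_mat_def diag_of_def diag_mats_iff)
    ultimately show "B \<in> red_mat R P n ` diag_mats R d" by blast
  qed
qed


section \<open>Powers of the maximal ideal\<close>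

text \<open>
  Fixing the generator \<open>c < 1\<close> of the value group and an element \<open>\<pi>\<close> of absolute value \<open>c\<close> makes the
  powers of the maximal ideal the sets \<open>{x. \<nu> x \<le> c\<^sup>n}\<close>.
\<close>

locale uniformized_local_field = nonarch_local_field +
  fixes c :: real and \<pi> :: 'a
  assumes c: "0 < c" "c < 1"
    and uniformizer: "\<pi> \<in> carrier K" "\<nu> \<pi> = c"
    and value_group: "\<lbrakk>x \<in> carrier K; x \<noteq> \<zero>\<rbrakk> \<Longrightarrow> \<exists>k::int. \<nu> x = c powi k"

lemma (in nonarch_local_field) uniformized:
  "\<exists>c \<pi>. uniformized_local_field K \<nu> c \<pi>"
proof -
  obtain c where c: "0 < c" "c < 1" and v: "\<nu> ` (carrier K - {\<zero>}) = range (\<lambda>k::int. c powi k)"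
    using discrete by blast
  have "c powi 1 \<in> \<nu> ` (carrier K - {\<zero>})" unfolding v by blast
  then obtain p where "p \<in> carrier K" "\<nu> p = c" by auto
  then have "uniformized_local_field K \<nu> c p"
    using c v by unfold_locales auto
  then show ?thesis by blast
qed

context uniformized_local_field
begin

abbreviation R where "R \<equiv> val_ring K \<nu>"

definition ideal_pow :: "nat \<Rightarrow> 'a set" where
  "ideal_pow n = {x \<in> carrier K. \<nu> x \<le> c ^ n}"

lemma value_nat:
  assumes "x \<in> carrier K" "x \<noteq> \<zero>" "\<nu> x \<le> 1"
  shows "\<exists>k::nat. \<nu> x = c ^ k"
proof -
  obtain k :: int where k: "\<nu> x = c powi k" using value_group assms by blast
  have "0 \<le> k"
  proof (rule ccontr)
    assume "\<not> 0 \<le> k"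
    then have "1 < c powi k"
      using c by (simp add: power_int_def one_less_power one_less_inverse_iff)
    then show False using k assms by simp
  qed
  then show ?thesis using k by (intro exI[of _ "nat k"]) (simp add: power_int_def)
qed

text \<open>
  The value group is discrete, so no absolute value lies strictly between \<open>c\<^sup>n\<^sup>+\<^sup>1\<close> and \<open>c\<^sup>n\<close>.
\<close>

lemma value_gap:
  assumes x: "x \<in> carrier K" "\<nu> x < c ^ n"
  shows "\<nu> x \<le> c ^ Suc n"
proof (cases "x = \<zero>")
  case False
  have "\<nu> x \<le> 1" using x c power_le_one[of c n] by linarith
  then obtain k where k: "\<nu> x = c ^ k" using value_nat x False by blast
  then have "n < k" using x c by (simp add: power_strict_decreasing_iff)
  then show ?thesis using k c by (simp add: power_decreasing del: power_Suc)
qed (use c abs_zero in simp)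

lemma abs_minus_le:
  "\<lbrakk>x \<in> carrier K; y \<in> carrier K; \<nu> x \<le> r; \<nu> y \<le> r\<rbrakk> \<Longrightarrow> \<nu> (x \<ominus> y) \<le> r"
  using abs_ultrametric[of x "\<ominus> y"] by (simp add: abs_minus a_minus_def)

lemma ideal_pow_0: "ideal_pow 0 = carrier R"
  by (simp add: ideal_pow_def val_ring_def)

lemma ideal_pow_1: "ideal_pow (Suc 0) = val_ideal K \<nu>"
  using value_gap[of _ 0] c by (force simp: ideal_pow_def val_ideal_def)

lemma ideal_pow_mono: "m \<le> n \<Longrightarrow> ideal_pow n \<subseteq> ideal_pow m"
  using c power_decreasing[of m n c] by (auto simp: ideal_pow_def intro: order_trans)

lemma ideal_pow_sub: "ideal_pow n \<subseteq> carrier R"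
  using ideal_pow_mono[of 0 n] by (simp add: ideal_pow_0)

lemma pi_pow: "\<pi> [^] n \<in> carrier K" "\<nu> (\<pi> [^] n) = c ^ n" "\<pi> [^] n \<noteq> \<zero>"
proof -
  show 1: "\<pi> [^] n \<in> carrier K" using uniformizer by simp
  show 2: "\<nu> (\<pi> [^] n) = c ^ n"
    by (induction n) (use uniformizer in \<open>simp_all add: abs_one abs_mult mult.commute\<close>)
  show "\<pi> [^] n \<noteq> \<zero>" using 2 c abs_zero by (metis less_irrefl zero_less_power)
qed

lemma ideal_pow_divide:
  assumes "x \<in> ideal_pow (i + j)"
  obtains u where "u \<in> ideal_pow j" "x = \<pi> [^] i \<otimes> u"
proof
  have x: "x \<in> carrier K" "\<nu> x \<le> c ^ (i + j)" using assms by (auto simp: ideal_pow_def)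
  note inv = abs_inv[OF pi_pow(1,3), of i]
  show "x = \<pi> [^] i \<otimes> (inv (\<pi> [^] i) \<otimes> x)"
    using inv x pi_pow(1)[of i] by (simp add: m_assoc[symmetric])
  have "\<nu> (inv (\<pi> [^] i) \<otimes> x) = inverse (c ^ i) * \<nu> x"
    using inv x pi_pow by (simp add: abs_mult)
  also have "\<dots> \<le> inverse (c ^ i) * c ^ (i + j)"
    using x c by (intro mult_left_mono) auto
  also have "\<dots> = c ^ j" using c by (simp add: power_add)
  finally show "inv (\<pi> [^] i) \<otimes> x \<in> ideal_pow j"
    using inv x by (simp add: ideal_pow_def)
qed

lemma ideal_prod_pow: "ideal_prod R (ideal_pow n) (val_ideal K \<nu>) = ideal_pow (Suc n)"
proof (intro equalityI subsetI)
  fix x assume "x \<in> ideal_prod R (ideal_pow n) (val_ideal K \<nu>)"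
  then show "x \<in> ideal_pow (Suc n)"
  proof induction
    case (prod i j)
    then have "j \<in> ideal_pow (Suc 0)" by (simp add: ideal_pow_1)
    with prod have "\<nu> i * \<nu> j \<le> c ^ n * c"
      using c by (intro mult_mono) (auto simp: ideal_pow_def abs_nonneg)
    then show ?case using prod
      by (simp add: ideal_pow_def val_ideal_def val_ring_def abs_mult mult.commute)
  next
    case (sum s t)
    then show ?case using abs_ultrametric[of s t] by (auto simp: ideal_pow_def val_ring_def)
  qed
next
  fix x assume "x \<in> ideal_pow (Suc n)"
  then obtain u where u: "u \<in> ideal_pow n" "x = \<pi> [^] (1::nat) \<otimes> u"
    using ideal_pow_divide[of x 1 n] by auto
  have p: "\<pi> [^] (1::nat) \<in> val_ideal K \<nu>"
    using pi_pow[of 1] by (simp add: ideal_pow_def flip: ideal_pow_1)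
  have "x = u \<otimes>\<^bsub>R\<^esub> (\<pi> [^] (1::nat))"
    using u p by (simp add: val_ring_def val_ideal_def ideal_pow_def m_comm)
  then show "x \<in> ideal_prod R (ideal_pow n) (val_ideal K \<nu>)"
    using ideal_prod.prod[OF u(1) p, of R] by simp
qed

lemma val_ideal_pow: "val_ideal K \<nu> [^]\<^bsub>ideals_set R\<^esub> n = ideal_pow n"
  by (induction n)
    (simp_all add: nat_pow_def ideals_set_def ideal_pow_0 ideal_prod_pow)

lemma ideal_pow_ideal: "ideal (ideal_pow n) R"
proof (induction n)
  interpret R: cring R by (rule val_ring_cring)
  case 0
  show ?case unfolding ideal_pow_0 by (rule R.oneideal)
next
  interpret R: cring R by (rule val_ring_cring)
  case (Suc n)
  show ?case
    using R.ideal_prod_is_ideal[OF Suc val_ideal_ideal] by (simp add: ideal_prod_pow)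
qed

lemma minus_R: "\<lbrakk>x \<in> carrier R; y \<in> carrier R\<rbrakk> \<Longrightarrow> x \<ominus>\<^bsub>R\<^esub> y = x \<ominus> y"
proof -
  interpret R: cring R by (rule val_ring_cring)
  assume xy: "x \<in> carrier R" "y \<in> carrier R"
  have "\<ominus>\<^bsub>R\<^esub> y = \<ominus> y"
    using xy by (intro R.minus_equality) (auto simp: val_ring_def abs_minus l_neg)
  then show ?thesis by (simp add: a_minus_def val_ring_def)
qed

section \<open>The residue rings and their filtration\<close>

abbreviation coset where "coset n x \<equiv> ideal_pow n +>\<^bsub>R\<^esub> x"
abbreviation Q where "Q n \<equiv> R Quot ideal_pow n"

lemma coset_eq_iff:
  assumes "x \<in> carrier R" "y \<in> carrier R"
  shows "coset n x = coset n y \<longleftrightarrow> \<nu> (x \<ominus> y) \<le> c ^ n"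
proof -
  interpret R: cring R by (rule val_ring_cring)
  have "coset n x = coset n y \<longleftrightarrow> x \<ominus> y \<in> ideal_pow n"
    using R.quotient_eq_iff_same_a_r_cos[OF ideal_pow_ideal assms] minus_R[OF assms] by simp
  then show ?thesis using assms by (auto simp: ideal_pow_def val_ring_def)
qed

lemma coset_add:
  assumes "x \<in> carrier R" "y \<in> carrier R"
  shows "coset n x \<oplus>\<^bsub>Q n\<^esub> coset n y = coset n (x \<oplus> y)"
  using ring_hom_add[OF ideal.rcos_ring_hom[OF ideal_pow_ideal] assms]
  by (simp add: val_ring_def)

lemma coset_mult:
  assumes "x \<in> carrier R" "y \<in> carrier R"
  shows "coset n x \<otimes>\<^bsub>Q n\<^esub> coset n y = coset n (x \<otimes> y)"
  using ring_hom_mult[OF ideal.rcos_ring_hom[OF ideal_pow_ideal] assms]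
  by (simp add: val_ring_def)

lemma coset_eq_zero_iff:
  assumes "x \<in> carrier R"
  shows "coset n x = \<zero>\<^bsub>Q n\<^esub> \<longleftrightarrow> \<nu> x \<le> c ^ n"
proof -
  interpret R: cring R by (rule val_ring_cring)
  have z: "\<zero>\<^bsub>Q n\<^esub> = coset n \<zero>"
    using R.a_rcos_zero[OF ideal_pow_ideal[of n], of \<zero>] abs_zero c
    by (simp add: FactRing_def ideal_pow_def)
  have "\<zero> \<in> carrier R" using abs_zero by (simp add: val_ring_def)
  then show ?thesis
    using coset_eq_iff[OF assms, of \<zero> n] assms unfolding z by (simp add: val_ring_def a_minus_def)
qed

text \<open>
  For \<open>j \<le> n\<close> these are all the ideals of the residue ring, and they turn out to be the
  annihilators of its elements.
\<close>

definition level :: "nat \<Rightarrow> nat \<Rightarrow> 'a set set" where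
  "level n j = coset n ` ideal_pow j"

lemma carrier_Q: "carrier (Q n) = level n 0"
  by (auto simp: level_def ideal_pow_0 FactRing_def A_RCOSETS_def')

lemma residue_card_level: "residue_card K \<nu> = card (level 1 0)"
  by (simp add: residue_card_def flip: carrier_Q ideal_pow_1)

lemma residue_card_pos: "0 < residue_card K \<nu>"
proof -
  have "finite (level 1 0)"
    using finite_residue_field by (simp flip: carrier_Q ideal_pow_1)
  moreover have "coset 1 \<zero> \<in> level 1 0"
    using abs_zero by (simp add: level_def ideal_pow_def)
  ultimately show ?thesis by (auto simp: residue_card_level card_gt_0_iff)
qed

text \<open>
  An element of \<open>P\<^sup>j\<close> is \<open>\<pi>\<^sup>j u\<close> with \<open>u\<close> integral. Splitting off a fixed representative \<open>s\<close> of
  the residue class of \<open>u\<close> gives \<open>\<pi>\<^sup>j s + y\<close> with \<open>y\<close> in \<open>P\<^sup>j\<^sup>+\<^sup>1\<close>, and \<open>y\<close> is determined modulo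
  \<open>P\<^sup>n\<close> by the given element.
\<close>

lemma card_level_Suc:
  assumes "j < n"
  shows "card (level n j) = residue_card K \<nu> * card (level n (Suc j))"
proof -
  define rep where "rep D = (SOME x. x \<in> carrier R \<and> D = coset 1 x)" for D
  have rep: "rep D \<in> carrier R" "D = coset 1 (rep D)" if "D \<in> level 1 0" for D
  proof -
    have "\<exists>x. x \<in> carrier R \<and> D = coset 1 x" using that by (auto simp: level_def ideal_pow_0)
    from someI_ex[OF this] show "rep D \<in> carrier R" "D = coset 1 (rep D)"
      unfolding rep_def by blast+
  qed
  have cn: "c ^ n \<le> c ^ Suc j" using assms c by (intro power_decreasing) auto
  let ?h = "\<lambda>(D, C). coset n (\<pi> [^] j \<otimes> rep D) \<oplus>\<^bsub>Q n\<^esub> C"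
  have scale: "\<pi> [^] j \<otimes> s \<in> ideal_pow j" if "s \<in> carrier R" for s
    using that pi_pow[of j] c
    by (auto simp: ideal_pow_def val_ring_def abs_mult intro: mult_left_le)
  have h: "?h (D, coset n y) = coset n (\<pi> [^] j \<otimes> rep D \<oplus> y)"
    if "D \<in> level 1 0" "y \<in> ideal_pow (Suc j)" for D y
    using coset_add[of "\<pi> [^] j \<otimes> rep D" y n] scale[OF rep(1)[OF that(1)]] that ideal_pow_sub
    by (simp add: subset_iff)
  have "bij_betw ?h (level 1 0 \<times> level n (Suc j)) (level n j)"
    unfolding bij_betw_def
  proof
    show "inj_on ?h (level 1 0 \<times> level n (Suc j))"
    proof (rule inj_onI)
      fix p p' assume p: "p \<in> level 1 0 \<times> level n (Suc j)" "p' \<in> level 1 0 \<times> level n (Suc j)"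
        and eq: "?h p = ?h p'"
      from p(1) obtain D y where D: "D \<in> level 1 0" "y \<in> ideal_pow (Suc j)" "p = (D, coset n y)"
        by (auto simp: level_def)
      from p(2) obtain D' y' where D': "D' \<in> level 1 0" "y' \<in> ideal_pow (Suc j)" "p' = (D', coset n y')"
        by (auto simp: level_def)
      define s s' where "s = rep D" and "s' = rep D'"
      have K: "s \<in> carrier K" "s' \<in> carrier K" "y \<in> carrier K" "y' \<in> carrier K" "\<pi> [^] j \<in> carrier K"
        using rep(1)[OF D(1)] rep(1)[OF D'(1)] D D' pi_pow(1)
        by (auto simp: s_def s'_def ideal_pow_def val_ring_def)
      have yR: "y \<in> carrier R" "y' \<in> carrier R" using D D' ideal_pow_sub by auto
      have sR: "s \<in> carrier R" "s' \<in> carrier R" using rep D D' by (auto simp: s_def s'_def)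
      have sc: "\<pi> [^] j \<otimes> s \<in> carrier R" "\<pi> [^] j \<otimes> s' \<in> carrier R"
        using scale[OF sR(1)] scale[OF sR(2)] ideal_pow_sub by auto
      have sum: "\<pi> [^] j \<otimes> s \<oplus> y \<in> carrier R" "\<pi> [^] j \<otimes> s' \<oplus> y' \<in> carrier R"
        using sc yR cring.cring_simprules(1)[OF val_ring_cring] by (simp_all add: val_ring_def)
      \<comment> \<open>representatives of equal images differ by an element of absolute value at most \<open>c\<^sup>n \<le> c\<^sup>j\<^sup>+\<^sup>1\<close>,
         so the leading digits agree first and then the remainders\<close>
      have d: "\<nu> ((\<pi> [^] j \<otimes> s \<oplus> y) \<ominus> (\<pi> [^] j \<otimes> s' \<oplus> y')) \<le> c ^ n"
        using eq h[OF D(1,2)] h[OF D'(1,2)] coset_eq_iff[OF sum] D D' by (simp add: s_def s'_def)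
      have "\<pi> [^] j \<otimes> (s \<ominus> s') =
          ((\<pi> [^] j \<otimes> s \<oplus> y) \<ominus> (\<pi> [^] j \<otimes> s' \<oplus> y')) \<ominus> (y \<ominus> y')"
        using K unfolding a_minus_def by algebra
      also have "\<nu> \<dots> \<le> c ^ Suc j"
      proof (rule abs_minus_le)
        show "\<nu> ((\<pi> [^] j \<otimes> s \<oplus> y) \<ominus> (\<pi> [^] j \<otimes> s' \<oplus> y')) \<le> c ^ Suc j"
          using d cn by linarith
        show "\<nu> (y \<ominus> y') \<le> c ^ Suc j"
          using K D D' by (intro abs_minus_le) (auto simp: ideal_pow_def)
      qed (use K in auto)
      finally have "\<nu> (s \<ominus> s') \<le> c"
        using K pi_pow c by (simp add: abs_mult)
      then have DD: "D = D'"
        using rep(2)[OF D(1)] rep(2)[OF D'(1)] coset_eq_iff[OF sR, of 1] by (simp add: s_def s'_def)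
      have "y \<ominus> y' = (\<pi> [^] j \<otimes> s \<oplus> y) \<ominus> (\<pi> [^] j \<otimes> s \<oplus> y')"
        using K unfolding a_minus_def by algebra
      then have "coset n y = coset n y'"
        using d DD coset_eq_iff[OF yR] by (simp add: s_def s'_def)
      then show "p = p'" using D D' DD by simp
    qed
    have "?h p \<in> level n j" if p: "p \<in> level 1 0 \<times> level n (Suc j)" for p
    proof -
      from p obtain D y where D: "D \<in> level 1 0" "y \<in> ideal_pow (Suc j)" "p = (D, coset n y)"
        by (auto simp: level_def)
      have "\<pi> [^] j \<otimes> rep D \<oplus> y \<in> ideal_pow j"
        using scale[OF rep(1)[OF D(1)]] D(2) ideal_pow_mono[of j "Suc j"]
          additive_subgroup.a_closed[OF ideal.axioms(1)[OF ideal_pow_ideal]]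
        by (auto simp: val_ring_def)
      then show ?thesis using h[OF D(1,2)] D by (auto simp: level_def)
    qed
    moreover have "\<exists>p\<in>level 1 0 \<times> level n (Suc j). z = ?h p" if z: "z \<in> level n j" for z
    proof -
      obtain x where x: "x \<in> ideal_pow j" "z = coset n x" using z by (auto simp: level_def)
      then obtain u where u: "u \<in> ideal_pow 0" "x = \<pi> [^] j \<otimes> u"
        using ideal_pow_divide[of x j 0] by auto
      define D where "D = coset 1 u"
      have D: "D \<in> level 1 0" using u by (simp add: D_def level_def)
      have uR: "u \<in> carrier R" using u by (simp add: ideal_pow_0)
      have K: "u \<in> carrier K" "rep D \<in> carrier K" "\<pi> [^] j \<in> carrier K"
        using uR rep(1)[OF D] pi_pow(1) by (auto simp: val_ring_def)
      have "\<nu> (u \<ominus> rep D) \<le> c"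
        using coset_eq_iff[OF uR rep(1)[OF D], of 1] rep(2)[OF D] by (simp add: D_def)
      then have y: "\<pi> [^] j \<otimes> (u \<ominus> rep D) \<in> ideal_pow (Suc j)"
        using K pi_pow c by (simp add: ideal_pow_def abs_mult)
      have "\<pi> [^] j \<otimes> rep D \<oplus> \<pi> [^] j \<otimes> (u \<ominus> rep D) = x"
        using K unfolding u(2) a_minus_def by algebra
      then have "z = ?h (D, coset n (\<pi> [^] j \<otimes> (u \<ominus> rep D)))"
        unfolding h[OF D y] x(2) by simp
      then show ?thesis using D y
        by (intro bexI[of _ "(D, coset n (\<pi> [^] j \<otimes> (u \<ominus> rep D)))"]) (auto simp: level_def)
    qed
    ultimately show "?h ` (level 1 0 \<times> level n (Suc j)) = level n j" by blast
  qed
  then show ?thesis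
    by (simp add: bij_betw_same_card[symmetric] card_cartesian_product residue_card_level)
qed

lemma level_self: "level n n = {\<zero>\<^bsub>Q n\<^esub>}"
proof -
  have "coset n x = \<zero>\<^bsub>Q n\<^esub>" if "x \<in> ideal_pow n" for x
    using coset_eq_zero_iff[of x n] that ideal_pow_sub by (auto simp: ideal_pow_def)
  moreover have "\<zero> \<in> ideal_pow n" using abs_zero c by (simp add: ideal_pow_def)
  ultimately show ?thesis by (auto simp: level_def)
qed

lemma card_level:
  assumes "j \<le> n"
  shows "card (level n j) = residue_card K \<nu> ^ (n - j)"
  using assms
proof (induction j rule: inc_induct)
  case base
  then show ?case by (simp add: level_self)
next
  case (step j)
  then show ?case by (simp add: card_level_Suc Suc_diff_Suc flip: power_Suc)
qed

lemma finite_level: "j \<le> n \<Longrightarrow> finite (level n j)"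
  using card_level[of j n] residue_card_pos by (intro card_ge_0_finite) simp

section \<open>Counting annihilators in the residue rings\<close>

text \<open>
  If \<open>\<nu> x = c\<^sup>i\<close>, then \<open>\<nu> (x y) \<le> c\<^sup>n\<close> amounts to \<open>\<nu> y \<le> c\<^sup>n\<^sup>-\<^sup>i\<close>.
\<close>

lemma annihilator_coset:
  assumes x: "x \<in> carrier K" "\<nu> x = c ^ i" and i: "i \<le> n"
  shows "annihilator (Q n) (coset n x) = level n (n - i)"
proof -
  have xR: "x \<in> carrier R" using x c by (simp add: val_ring_def power_le_one)
  have "coset n x \<otimes>\<^bsub>Q n\<^esub> coset n y = \<zero>\<^bsub>Q n\<^esub> \<longleftrightarrow> y \<in> ideal_pow (n - i)" if y: "y \<in> carrier R" for y
  proof -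
    have yK: "y \<in> carrier K" using y by (simp add: val_ring_def)
    have xy: "x \<otimes> y \<in> carrier R"
      using cring.cring_simprules(5)[OF val_ring_cring xR y] by (simp add: val_ring_def)
    have "coset n x \<otimes>\<^bsub>Q n\<^esub> coset n y = \<zero>\<^bsub>Q n\<^esub> \<longleftrightarrow> c ^ i * \<nu> y \<le> c ^ n"
      using coset_mult[OF xR y] coset_eq_zero_iff[OF xy] x yK by (simp add: abs_mult)
    also have "c ^ n = c ^ i * c ^ (n - i)" using i by (simp flip: power_add)
    finally show ?thesis using c yK by (simp add: ideal_pow_def)
  qed
  then show ?thesis
    using ideal_pow_sub[of "n - i"]
    by (auto simp: annihilator_def carrier_Q level_def ideal_pow_0 intro!: imageI)
qed

text \<open>
  Each shell \<open>level n j - level n (j + 1)\<close> has \<open>q\<^sup>n\<^sup>-\<^sup>j - q\<^sup>n\<^sup>-\<^sup>j\<^sup>-\<^sup>1\<close> elements whose annihilators have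
  \<open>q\<^sup>j\<close> elements. So every shell contributes \<open>q\<^sup>n (1 - 1/q)\<close>, independently of \<open>j\<close>, and the zero
  element contributes \<open>q\<^sup>n\<close>.
\<close>

lemma sum_annihilator_level:
  assumes "j \<le> n"
  defines "q \<equiv> of_nat (residue_card K \<nu>) :: rat"
  shows "(\<Sum>C\<in>level n j. of_nat (card (annihilator (Q n) C))) =
    q ^ n * (1 + of_nat (n - j) * (1 - inverse q))"
  using assms(1)
proof (induction j rule: inc_induct)
  case base
  interpret Q: ring "Q n" by (rule ideal.quotient_is_ring[OF ideal_pow_ideal])
  have "annihilator (Q n) \<zero>\<^bsub>Q n\<^esub> = level n 0"
    by (auto simp: annihilator_def carrier_Q)
  then show ?case by (simp add: level_self card_level q_def)
next
  case (step j)
  have q0: "q \<noteq> 0" using residue_card_pos by (simp add: q_def)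
  have sub: "level n (Suc j) \<subseteq> level n j"
    using ideal_pow_mono[of j "Suc j"] by (auto simp: level_def)
  have fin: "finite (level n j)" using step finite_level by simp
  have "of_nat (card (annihilator (Q n) C)) = q ^ j" if C: "C \<in> level n j - level n (Suc j)" for C
  proof -
    obtain x where x: "x \<in> carrier K" "\<nu> x \<le> c ^ j" "C = coset n x"
      using C by (auto simp: level_def ideal_pow_def)
    then have "\<not> \<nu> x \<le> c ^ Suc j" using C by (auto simp: level_def ideal_pow_def)
    then have "\<nu> x = c ^ j" using x value_gap[of x j] by linarith
    then show ?thesis
      using annihilator_coset[OF x(1), of j n] step x card_level[of "n - j" n] by (simp add: q_def)
  qed
  then have "(\<Sum>C\<in>level n j - level n (Suc j). of_nat (card (annihilator (Q n) C))) =
      of_nat (card (level n j - level n (Suc j))) * q ^ j"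
    by simp
  also have "of_nat (card (level n j - level n (Suc j))) = q ^ (n - j) - q ^ (n - Suc j)"
    using card_Diff_subset[OF finite_subset[OF sub fin] sub] card_mono[OF fin sub] step
    by (simp add: card_level q_def of_nat_diff)
  also have "q ^ (n - j) = q * q ^ (n - Suc j)"
    using step by (simp add: Suc_diff_Suc flip: power_Suc)
  also have "(q * q ^ (n - Suc j) - q ^ (n - Suc j)) * q ^ j = q ^ n * (1 - inverse q)"
  proof -
    have "q ^ n = q ^ (Suc (n - Suc j) + j)" using step by simp
    then show ?thesis using q0 by (simp add: power_add field_simps)
  qed
  finally have diff: "(\<Sum>C\<in>level n j - level n (Suc j). of_nat (card (annihilator (Q n) C)))
      = q ^ n * (1 - inverse q)" .
  have "(of_nat (n - j) :: rat) = of_nat (n - Suc j) + 1"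
    using step by (simp flip: of_nat_Suc add: Suc_diff_Suc)
  then show ?case
    using sum.subset_diff[OF sub fin, of "\<lambda>C. of_nat (card (annihilator (Q n) C)) :: rat"] diff step.IH
    by (simp add: algebra_simps)
qed

lemma average_annihilator:
  defines "q \<equiv> of_nat (residue_card K \<nu>) :: rat"
  shows "(\<Sum>a\<in>carrier (Q n). of_nat (card (annihilator (Q n) a))) / of_nat (card (carrier (Q n)))
    = 1 + (1 - inverse q) * of_nat n"
  using sum_annihilator_level[of 0 n] card_level[of 0 n] residue_card_pos
  by (simp add: carrier_Q q_def mult.commute)

lemma ask_zeta_diag_mats:
  "ask_zeta R (val_ideal K \<nu>) d (diag_mats R d) =
    Abs_fps (\<lambda>n. (1 + (1 - inverse (of_nat (residue_card K \<nu>))) * of_nat n) ^ d)"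
proof (rule fps_ext)
  fix n
  interpret Q: cring "Q n"
    by (rule ideal.quotient_is_cring[OF ideal_pow_ideal val_ring_cring])
  have fin: "finite (carrier (Q n))" by (simp add: carrier_Q finite_level)
  have "red_mat R (val_ideal K \<nu>) n ` diag_mats R d = diag_mats (Q n) d"
    using red_mat_diag_mats[where P = "val_ideal K \<nu>" and R = R and n = n and d = d] ideal_pow_ideal[of n]
    by (simp add: val_ideal_pow res_ring_def)
  then show "fps_nth (ask_zeta R (val_ideal K \<nu>) d (diag_mats R d)) n =
      fps_nth (Abs_fps (\<lambda>n. (1 + (1 - inverse (of_nat (residue_card K \<nu>))) * of_nat n) ^ d)) n"
    using Q.average_Ker_diag[OF fin, of d]
    by (simp add: ask_zeta_def res_ring_def val_ideal_pow average_annihilator)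
qed

end

section \<open>The ask zeta function of diagonal matrices\<close>

theorem corollary5p17:
  fixes K :: "('a, 'b) ring_scheme" and \<nu> :: "'a \<Rightarrow> real" and d :: nat
  assumes "nonarch_local_field K \<nu>" and "d \<ge> 1"
  shows "ask_zeta (val_ring K \<nu>) (val_ideal K \<nu>) d (diag_mats (val_ring K \<nu>) d) =
    h_poly d (fps_const (- inverse (of_nat (residue_card K \<nu>)))) fps_X / (1 - fps_X) ^ (d + 1)"
proof -
  obtain c \<pi> where "uniformized_local_field K \<nu> c \<pi>"
    using nonarch_local_field.uniformized[OF assms(1)] by blast
  then interpret uniformized_local_field K \<nu> c \<pi> .
  let ?x = "- inverse (of_nat (residue_card K \<nu>)) :: rat"
  have "ask_zeta R (val_ideal K \<nu>) d (diag_mats R d) = Abs_fps (\<lambda>m. (1 + (1 + ?x) * of_nat m) ^ d)"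
    using ask_zeta_diag_mats[of d] by simp
  moreover have "(1 - fps_X) ^ (d + 1) \<noteq> (0 :: rat fps)"
  proof -
    have "fps_nth (1 - fps_X :: rat fps) 0 = 1" by simp
    then have "1 - fps_X \<noteq> (0 :: rat fps)" by (metis fps_zero_nth zero_neq_one)
    then show ?thesis by simp
  qed
  ultimately show ?thesis
    unfolding h_poly_gf by (metis nonzero_mult_div_cancel_right)
qed

end
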